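(* Let $A\in\mathbb{R}^{m\times n}$, $b\in\mathbb{R}^m$, and let $M\in\mathbb{R}^{m\times m}$, $N\in\mathbb{R}^{n\times n}$ be symmetric positive definite. Let $k\geq 1$ and suppose the generalized Golub-Kahan bidiagonalization (gen-GKB) of $A$ with starting vector $b$ does not break down before producing $u_1,\dots,u_k$ and $v_1,\dots,v_k$ (i.e. $\alpha_i\neq 0$ and $\beta_i\neq 0$ for $1\leq i\leq k$). Then $\{u_i\}_{i=1}^{k}$ is an $M^{-1}$-orthonormal basis of the Krylov subspace $$\mathcal{K}_k(ANA^{\top}M^{-1}, b) = \mathrm{span}\{(ANA^{\top}M^{-1})^i b\}_{i=0}^{k-1},$$ and $\{v_i\}_{i=1}^{k}$ is an $N^{-1}$-orthonormal basis of the Krylov subspace $$\mathcal{K}_k(NA^{\top}M^{-1}A, NA^{\top}M^{-1}b) = \mathrm{span}\{(NA^{\top}M^{-1}A)^i NA^{\top}M^{-1}b\}_{i=0}^{k-1}.$$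
   Context: For a symmetric positive definite matrix $B$, $\langle x,x'\rangle_{B}=x^{\top}Bx'$ and $\|x\|_B=(x^{\top}Bx)^{1/2}$; vectors $w_1,\dots,w_k$ are $B$-orthonormal if $\langle w_i,w_j\rangle_B=\delta_{ij}$. Gen-GKB: regard $A$ as a linear operator from $(\mathbb{R}^n,\langle\cdot,\cdot\rangle_{N^{-1}})$ to $(\mathbb{R}^m,\langle\cdot,\cdot\rangle_{M^{-1}})$ with adjoint $A^{*}$, defined by $\langle Ax,y\rangle_{M^{-1}}=\langle x,A^{*}y\rangle_{N^{-1}}$ for all $x,y$; explicitly $A^{*}=NA^{\top}M^{-1}$. Vectors $u_i\in\mathbb{R}^m$, $v_i\in\mathbb{R}^n$ and scalars $\alpha_i,\beta_i\ge 0$ are generated by $$\beta_1u_1=b,\qquad \alpha_i v_i = A^{*}u_i-\beta_i v_{i-1},\qquad \beta_{i+1}u_{i+1}=Av_i-\alpha_i u_i\qquad (i=1,2,\dots),$$ with $v_0=0$, where $\alpha_i,\beta_i$ are the normalization constants such that $\|u_i\|_{M^{-1}}=\|v_i\|_{N^{-1}}=1$ (the process terminates as soon as some $\alpha_i$ or $\beta_i$ vanishes). *)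

theory Defs
  imports "HOL-Analysis.Analysis"
begin

definition sym_pos_def :: "real^'n^'n \<Rightarrow> bool" where
  "sym_pos_def B \<longleftrightarrow> transpose B = B \<and> (\<forall>x. x \<noteq> 0 \<longrightarrow> 0 < x \<bullet> (B *v x))"

definition winner :: "real^'n^'n \<Rightarrow> real^'n \<Rightarrow> real^'n \<Rightarrow> real" where
  "winner B x y = x \<bullet> (B *v y)"

definition wnorm :: "real^'n^'n \<Rightarrow> real^'n \<Rightarrow> real" where
  "wnorm B x = sqrt (winner B x x)"

definition worthonormal :: "real^'n^'n \<Rightarrow> 'i set \<Rightarrow> ('i \<Rightarrow> real^'n) \<Rightarrow> bool" where
  "worthonormal B I w \<longleftrightarrow> (\<forall>i\<in>I. \<forall>j\<in>I. winner B (w i) (w j) = (if i = j then 1 else 0))"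

definition basis_of :: "'i set \<Rightarrow> ('i \<Rightarrow> 'a::real_vector) \<Rightarrow> 'a set \<Rightarrow> bool" where
  "basis_of I w V \<longleftrightarrow> inj_on w I \<and> independent (w ` I) \<and> span (w ` I) = V"

text \<open>The powers of \<open>B\<close> are iterates of \<open>(*v) B\<close>: the overloaded power operation on
  \<open>real^'n^'n\<close> is componentwise.\<close>

definition krylov :: "real^'n^'n \<Rightarrow> real^'n \<Rightarrow> nat \<Rightarrow> (real^'n) set" where
  "krylov B b k = span {((*v) B ^^ i) b |i. i < k}"

text \<open>The adjoint of \<open>A\<close> as an operator from \<open>real^'n\<close> with the \<open>matrix_inv N\<close> inner product to
  \<open>real^'m\<close> with the \<open>matrix_inv M\<close> inner product.  For symmetric positive definite \<open>M\<close> and \<open>N\<close>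
  it exists and is unique, see \<open>wadjoint_eq\<close>.\<close>

definition wadjoint :: "real^'m^'m \<Rightarrow> real^'n^'n \<Rightarrow> real^'n^'m \<Rightarrow> real^'m \<Rightarrow> real^'n" where
  "wadjoint M N A =
     (THE S. \<forall>x y. winner (matrix_inv M) (A *v x) y = winner (matrix_inv N) x (S y))"

text \<open>The quantities below are the output of the first \<open>k\<close> steps of the process; indices outside
  \<open>{1..k}\<close> are unconstrained, except for \<open>v 0\<close>.  Absence of breakdown is not part of the
  definition.\<close>

definition gen_gkb ::
  "real^'n^'m \<Rightarrow> real^'m \<Rightarrow> real^'m^'m \<Rightarrow> real^'n^'n \<Rightarrow> nat \<Rightarrow>
   (nat \<Rightarrow> real) \<Rightarrow> (nat \<Rightarrow> real) \<Rightarrow> (nat \<Rightarrow> real^'m) \<Rightarrow> (nat \<Rightarrow> real^'n) \<Rightarrow> bool" where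
  "gen_gkb A b M N k \<alpha> \<beta> u v \<longleftrightarrow>
     v 0 = 0 \<and>
     \<beta> 1 *\<^sub>R u 1 = b \<and>
     (\<forall>i\<in>{1..k}. \<alpha> i *\<^sub>R v i = wadjoint M N A (u i) - \<beta> i *\<^sub>R v (i - 1)) \<and>
     (\<forall>i\<in>{1..<k}. \<beta> (i + 1) *\<^sub>R u (i + 1) = A *v v i - \<alpha> i *\<^sub>R u i) \<and>
     (\<forall>i\<in>{1..k}. 0 \<le> \<alpha> i \<and> 0 \<le> \<beta> i \<and>
        wnorm (matrix_inv M) (u i) = 1 \<and> wnorm (matrix_inv N) (v i) = 1)"

lemma sym_pos_def_invertible:
  assumes "sym_pos_def B"
  shows "invertible B"
proof -
  have "x = 0" if "B *v x = 0" for x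
    using assms that unfolding sym_pos_def_def by (metis inner_zero_right less_irrefl)
  then show ?thesis
    using invertible_left_inverse matrix_left_invertible_ker by blast
qed

lemma sym_pos_def_inv:
  assumes "sym_pos_def B"
  shows "B ** matrix_inv B = mat 1" "matrix_inv B ** B = mat 1"
  using someI_ex[OF sym_pos_def_invertible[OF assms, unfolded invertible_def]]
  unfolding matrix_inv_def by blast+

lemma sym_pos_def_transpose_inv:
  assumes "sym_pos_def B"
  shows "transpose (matrix_inv B) = matrix_inv B"
proof -
  have "transpose B = B" using assms by (simp add: sym_pos_def_def)
  then have "transpose (matrix_inv B) ** B = mat 1"
    using matrix_transpose_mul[of B "matrix_inv B"]
    by (simp add: sym_pos_def_inv(1)[OF assms])
  then have "transpose (matrix_inv B) ** (B ** matrix_inv B) = matrix_inv B"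
    by (simp add: matrix_mul_assoc)
  then show ?thesis
    by (simp add: sym_pos_def_inv(1)[OF assms])
qed

lemma wadjoint_eq:
  fixes A :: "real^'n^'m"
  assumes M: "sym_pos_def M" and N: "sym_pos_def N"
  shows "wadjoint M N A = (*v) (N ** transpose A ** matrix_inv M)"
proof -
  have inv_apply: "matrix_inv N *v (N *v z) = z" "N *v (matrix_inv N *v z) = z" for z
    by (simp_all add: matrix_vector_mul_assoc sym_pos_def_inv[OF N])
  have ex: "winner (matrix_inv M) (A *v x) y
      = winner (matrix_inv N) x ((N ** transpose A ** matrix_inv M) *v y)" for x y
  proof -
    have "(A *v x) \<bullet> z = x \<bullet> (transpose A *v z)" for z
      by (metis dot_lmul_matrix inner_commute transpose_matrix_vector)
    then show ?thesis
      by (simp only: winner_def matrix_vector_mul_assoc[symmetric] inv_apply)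
  qed
  show ?thesis
    unfolding wadjoint_def
  proof (rule the_equality)
    show "\<forall>x y. winner (matrix_inv M) (A *v x) y
      = winner (matrix_inv N) x ((N ** transpose A ** matrix_inv M) *v y)"
      using ex by blast
    fix S
    assume S: "\<forall>x y. winner (matrix_inv M) (A *v x) y = winner (matrix_inv N) x (S y)"
    show "S = (*v) (N ** transpose A ** matrix_inv M)"
    proof
      fix y
      have "x \<bullet> (matrix_inv N *v S y)
          = x \<bullet> (matrix_inv N *v ((N ** transpose A ** matrix_inv M) *v y))" for x
        using S ex by (metis winner_def)
      then have "matrix_inv N *v S y
          = matrix_inv N *v ((N ** transpose A ** matrix_inv M) *v y)"
        using vector_eq_ldot by blast
      then show "S y = (N ** transpose A ** matrix_inv M) *v y"
        by (metis inv_apply(2))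
    qed
  qed
qed

end

theory Submission
  imports Defs
begin

text \<open>
  Write \<open>T = N A\<^sup>T M\<^sup>-\<^sup>1\<close> for the adjoint of \<open>A\<close>, so that the two Krylov matrices are \<open>A T\<close> and \<open>T A\<close>.

  Orthonormality (\<open>gkb_orthonormal\<close>) is an induction that alternates between the two sequences.
  Pairing the recurrence for \<open>u (j + 1)\<close> with \<open>u i\<close>, \<open>i \<le> j\<close>, and moving \<open>A\<close> to the other side of
  the inner product leaves the pairing of \<open>v j\<close> with \<open>T u i = \<alpha> i v i + \<beta> i v (i - 1)\<close>, which is
  known by the induction hypothesis: it vanishes for \<open>i < j\<close>, and for \<open>i = j\<close> it equals \<open>\<alpha> j\<close> and
  cancels against the subtracted term.  In the same way, the new \<open>v (j + 1)\<close> is handled through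
  \<open>A v i = \<beta> (i + 1) u (i + 1) + \<alpha> i u i\<close>.  Thus the two-term recurrences
  give orthogonality to \<^emph>\<open>all\<close> earlier vectors, not only to the preceding one.

  For the spans, \<open>T\<close> maps the \<open>j\<close>-th Krylov space of \<open>(A T, b)\<close> into that of \<open>(T A, T b)\<close>, and \<open>A\<close>
  maps the latter back into the \<open>(j + 1)\<close>-st Krylov space of \<open>(A T, b)\<close>.  Dividing the recurrences
  by the nonzero \<open>\<alpha> j\<close> and \<open>\<beta> j\<close> therefore places \<open>u j\<close> and \<open>v j\<close> in the \<open>j\<close>-th Krylov spaces
  (\<open>gkb_in_krylov\<close>).  The reverse inclusion comes from counting: a Krylov space with \<open>k\<close>
  generators that contains \<open>k\<close> orthonormal, hence independent, vectors is spanned by them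
  (\<open>orthonormal_basis_of_krylov\<close>).
\<close>

section \<open>Weighted inner products\<close>

lemma winner_diff_left: "winner B (x - y) z = winner B x z - winner B y z"
  by (simp add: winner_def inner_diff_left)

lemma winner_add_right: "winner B x (y + z) = winner B x y + winner B x z"
  by (simp add: winner_def matrix_vector_right_distrib inner_add_right)

lemma winner_scaleR_left: "winner B (c *\<^sub>R x) y = c * winner B x y"
  by (simp add: winner_def)

lemma winner_scaleR_right: "winner B x (c *\<^sub>R y) = c * winner B x y"
  by (simp add: winner_def matrix_vector_mult_scaleR)

lemma winner_zero_right: "winner B x 0 = 0"
  by (simp add: winner_def)

lemmas winner_bilinear =
  winner_diff_left winner_add_right winner_scaleR_left winner_scaleR_right winner_zero_right

lemma winner_sym:
  assumes "transpose B = B"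
  shows "winner B x y = winner B y x"
  unfolding winner_def
  by (metis assms dot_lmul_matrix inner_commute transpose_matrix_vector)

text \<open>Each \<open>w i\<close> annihilates the span of the other vectors but has unit pairing with itself, so it
  cannot lie in that span.\<close>

lemma worthonormal_independent:
  assumes "worthonormal B I w"
  shows "inj_on w I" "independent (w ` I)"
proof -
  have one: "winner B (w i) (w j) = (if i = j then 1 else 0)" if "i \<in> I" "j \<in> I" for i j
    using assms that by (auto simp: worthonormal_def)
  show inj: "inj_on w I"
    by (rule inj_onI) (metis one zero_neq_one)
  show "independent (w ` I)"
    unfolding dependent_def
  proof clarify
    fix i assume i: "i \<in> I" and span: "w i \<in> span (w ` I - {w i})"
    have "winner B (w i) x = 0" if "x \<in> span (w ` I - {w i})" for x
      using that
    proof (induction rule: span_induct_alt)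
      case base
      show ?case by (simp add: winner_zero_right)
    next
      case (step c x y)
      then obtain j where "j \<in> I" "x = w j" "j \<noteq> i" by blast
      then show ?case using one i step by (simp add: winner_bilinear)
    qed
    with span one[OF i i] show False by auto
  qed
qed

section \<open>Krylov spaces\<close>

lemma krylov_power_mem: "i < k \<Longrightarrow> ((*v) B ^^ i) b \<in> krylov B b k"
  unfolding krylov_def by (rule span_base) blast

lemma subspace_krylov: "subspace (krylov B b k)"
  by (simp add: krylov_def)

lemma krylov_mono: "j \<le> k \<Longrightarrow> krylov B b j \<subseteq> krylov B b k"
  unfolding krylov_def by (rule span_mono) (auto intro: less_le_trans)

lemma krylov_shift_subset: "krylov B (B *v b) k \<subseteq> krylov B b (Suc k)"
  unfolding krylov_def[of B "B *v b"]
proof (rule span_minimal)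
  show "{((*v) B ^^ i) (B *v b) |i. i < k} \<subseteq> krylov B b (Suc k)"
  proof clarify
    fix i assume "i < k"
    then show "((*v) B ^^ i) (B *v b) \<in> krylov B b (Suc k)"
      using krylov_power_mem[of "Suc i" "Suc k" B b] by (simp add: funpow_swap1)
  qed
qed (rule subspace_krylov)

text \<open>Used with \<open>P = T\<close> and \<open>P = A\<close>: associativity alone gives \<open>T (A T) = (T A) T\<close> and
  \<open>A (T A) = (A T) A\<close>, so each map carries one Krylov space into the other.\<close>

lemma krylov_intertwine:
  assumes comm: "P ** B = C ** P" and "x \<in> krylov B b k"
  shows "P *v x \<in> krylov C (P *v b) k"
proof -
  have pow: "P *v (((*v) B ^^ i) b) = ((*v) C ^^ i) (P *v b)" for i
    by (induction i) (simp_all add: matrix_vector_mul_assoc comm flip: matrix_vector_mul_assoc[of C P])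
  have "P *v x \<in> (*v) P ` span {((*v) B ^^ i) b |i. i < k}"
    using assms(2) by (simp add: krylov_def)
  also have "\<dots> = span ((*v) P ` {((*v) B ^^ i) b |i. i < k})"
    by (simp add: linear_span_image)
  also have "(*v) P ` {((*v) B ^^ i) b |i. i < k} = {((*v) C ^^ i) (P *v b) |i. i < k}"
    by (force simp: pow[symmetric])
  finally show ?thesis
    by (simp add: krylov_def)
qed

lemma dim_krylov_le: "dim (krylov B b k) \<le> k"
proof -
  have gen: "{((*v) B ^^ i) b |i. i < k} = (\<lambda>i. ((*v) B ^^ i) b) ` {..<k}"
    by auto
  have "dim (krylov B b k) \<le> card ((\<lambda>i. ((*v) B ^^ i) b) ` {..<k})"
    unfolding krylov_def gen dim_span by (rule dim_le_card') simp
  also have "\<dots> \<le> k"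
    using card_image_le[of "{..<k}"] by simp
  finally show ?thesis .
qed

text \<open>The \<open>i\<close>-th vector is only asked to lie in the \<open>i\<close>-th Krylov space; that \<open>w\<close> exhausts the space
  is a matter of dimension, so the powers of \<open>C\<close> never have to be solved for in terms of \<open>w\<close>.\<close>

lemma orthonormal_basis_of_krylov:
  assumes orth: "worthonormal B {1..k} w"
    and mem: "\<And>i. 1 \<le> i \<Longrightarrow> i \<le> k \<Longrightarrow> w i \<in> krylov C b i"
  shows "basis_of {1..k} w (krylov C b k)"
proof -
  note indep = worthonormal_independent[OF orth]
  have sub: "w ` {1..k} \<subseteq> krylov C b k"
    using mem krylov_mono by fastforce
  have "card (w ` {1..k}) = k"
    using indep(1) by (simp add: card_image)
  then have "krylov C b k \<subseteq> span (w ` {1..k})"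
    using card_ge_dim_independent[OF sub indep(2)] dim_krylov_le[of C b k] by simp
  moreover have "span (w ` {1..k}) \<subseteq> krylov C b k"
    using sub subspace_krylov by (rule span_minimal)
  ultimately show ?thesis
    using indep by (auto simp: basis_of_def)
qed

section \<open>Golub-Kahan recurrences\<close>

text \<open>The recurrences enter only through a map \<open>S\<close> that is adjoint to \<open>A\<close> for two symmetric forms
  \<open>C\<close> and \<open>D\<close>, so the weights \<open>M\<close> and \<open>N\<close> and the explicit formula for the adjoint stay hidden.\<close>

lemma gkb_orthonormal:
  fixes A :: "real^'n^'m" and k :: nat
  assumes adj: "\<And>x y. winner C (A *v x) y = winner D x (S y)"
    and symC: "transpose C = C" and symD: "transpose D = D"
    and v0: "v 0 = 0"
    and rec_v: "\<And>i. 1 \<le> i \<Longrightarrow> i \<le> k \<Longrightarrow> \<alpha> i *\<^sub>R v i = S (u i) - \<beta> i *\<^sub>R v (i - 1)"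
    and rec_u: "\<And>i. 1 \<le> i \<Longrightarrow> i < k \<Longrightarrow> \<beta> (i + 1) *\<^sub>R u (i + 1) = A *v v i - \<alpha> i *\<^sub>R u i"
    and unit_u: "\<And>i. 1 \<le> i \<Longrightarrow> i \<le> k \<Longrightarrow> winner C (u i) (u i) = 1"
    and unit_v: "\<And>i. 1 \<le> i \<Longrightarrow> i \<le> k \<Longrightarrow> winner D (v i) (v i) = 1"
    and nz: "\<And>i. 1 \<le> i \<Longrightarrow> i \<le> k \<Longrightarrow> \<alpha> i \<noteq> 0 \<and> \<beta> i \<noteq> 0"
  shows "worthonormal C {1..k} u \<and> worthonormal D {1..k} v"
proof -
  have Su: "S (u i) = \<alpha> i *\<^sub>R v i + \<beta> i *\<^sub>R v (i - 1)" if "1 \<le> i" "i \<le> k" for i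
    using rec_v[OF that] by simp
  have Av: "A *v v i = \<beta> (i + 1) *\<^sub>R u (i + 1) + \<alpha> i *\<^sub>R u i" if "1 \<le> i" "i < k" for i
    using rec_u[OF that] by simp
  have below: "winner C (u j) (u i) = 0 \<and> winner D (v j) (v i) = 0"
    if "1 \<le> i" "i < j" "j \<le> k" for i j
    using that
  proof (induction j arbitrary: i rule: less_induct)
    case (less l)
    define j where "j = l - 1"
    have l: "l = j + 1" and j: "1 \<le> j" "j < k"
      using less.prems by (auto simp: j_def)
    have IH: "winner C (u j) (u i) = (if i = j then 1 else 0)"
        "winner D (v j) (v i) = (if i = j then 1 else 0)" if "1 \<le> i" "i \<le> j" for i
      using less.IH[of j i] that j l unit_u unit_v by auto
    have u_orth: "winner C (u l) (u i) = 0" if i: "1 \<le> i" "i \<le> j" for i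
    proof -
      \<comment> \<open>For \<open>i = 1\<close> the predecessor is \<open>v 0 = 0\<close>; otherwise \<open>i - 1 < j\<close> and orthogonality is known.\<close>
      have "winner D (v j) (v (i - 1)) = 0"
        using IH(2)[of "i - 1"] i v0 by (cases "i = 1") (auto simp: winner_zero_right)
      then have "winner C (A *v v j) (u i) = (if i = j then \<alpha> j else 0)"
        using i j by (simp add: adj Su winner_bilinear IH)
      moreover have "\<beta> l * winner C (u l) (u i)
          = winner C (A *v v j) (u i) - \<alpha> j * winner C (u j) (u i)"
        using rec_u[OF j] unfolding l by (metis winner_diff_left winner_scaleR_left)
      ultimately have "\<beta> l * winner C (u l) (u i) = 0"
        using IH(1)[OF i] by simp
      then show ?thesis
        using nz[of l] j l by simp
    qed
    have v_orth: "winner D (v l) (v i) = 0" if i: "1 \<le> i" "i \<le> j" for i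
    proof -
      have "winner D (S (u l)) (v i) = winner C (u l) (A *v v i)"
        using adj winner_sym[OF symC] winner_sym[OF symD] by metis
      also have "\<dots> = \<beta> (i + 1) * winner C (u l) (u (i + 1))"
        using i j by (simp add: Av winner_bilinear u_orth)
      \<comment> \<open>For \<open>i = j\<close> the vector \<open>u (i + 1)\<close> is \<open>u l\<close> itself; this is why \<open>u_orth\<close> has to precede.\<close>
      also have "\<dots> = (if i = j then \<beta> l else 0)"
        using u_orth[of "i + 1"] i j l unit_u[of l] by auto
      finally have "winner D (S (u l)) (v i) = (if i = j then \<beta> l else 0)" .
      moreover have "\<alpha> l * winner D (v l) (v i)
          = winner D (S (u l)) (v i) - \<beta> l * winner D (v j) (v i)"
        using rec_v[of l] j l by (metis Suc_eq_plus1 Suc_leI diff_Suc_1 le_add2 winner_diff_left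
            winner_scaleR_left)
      ultimately have "\<alpha> l * winner D (v l) (v i) = 0"
        using IH(2)[OF i] by simp
      then show ?thesis
        using nz[of l] j l by simp
    qed
    show ?case
      using u_orth v_orth less.prems l by simp
  qed
  have "winner C (u i) (u j) = (if i = j then 1 else 0)"
    "winner D (v i) (v j) = (if i = j then 1 else 0)" if "i \<in> {1..k}" "j \<in> {1..k}" for i j
    using that below[of i j] below[of j i] unit_u unit_v winner_sym[OF symC] winner_sym[OF symD]
    by (cases i j rule: linorder_cases; simp)+
  then show ?thesis
    by (simp add: worthonormal_def)
qed

text \<open>The Krylov index of \<open>u\<close> grows when \<open>A\<close> is applied to \<open>v j\<close>, while applying \<open>T\<close> to \<open>u j\<close> leaves
  it unchanged; so \<open>u j\<close> and \<open>v j\<close> stay at the same level, which the induction needs.\<close>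

lemma gkb_in_krylov:
  fixes A :: "real^'n^'m" and T :: "real^'m^'n" and k :: nat
  assumes v0: "v 0 = 0"
    and start: "\<beta> 1 *\<^sub>R u 1 = b"
    and rec_v: "\<And>i. 1 \<le> i \<Longrightarrow> i \<le> k \<Longrightarrow> \<alpha> i *\<^sub>R v i = T *v u i - \<beta> i *\<^sub>R v (i - 1)"
    and rec_u: "\<And>i. 1 \<le> i \<Longrightarrow> i < k \<Longrightarrow> \<beta> (i + 1) *\<^sub>R u (i + 1) = A *v v i - \<alpha> i *\<^sub>R u i"
    and nz: "\<And>i. 1 \<le> i \<Longrightarrow> i \<le> k \<Longrightarrow> \<alpha> i \<noteq> 0 \<and> \<beta> i \<noteq> 0"
    and "1 \<le> j" "j \<le> k"
  shows "u j \<in> krylov (A ** T) b j \<and> v j \<in> krylov (T ** A) (T *v b) j"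
proof -
  let ?K = "krylov (A ** T) b" and ?L = "krylov (T ** A) (T *v b)"
  have T: "T *v x \<in> ?L j" if "x \<in> ?K j" for x j
    using that by (rule krylov_intertwine[rotated]) (simp add: matrix_mul_assoc)
  have A: "A *v x \<in> ?K (Suc j)" if "x \<in> ?L j" for x j
  proof -
    have "A *v x \<in> krylov (A ** T) (A *v (T *v b)) j"
      using that by (rule krylov_intertwine[rotated]) (simp add: matrix_mul_assoc)
    then show ?thesis
      using krylov_shift_subset[of "A ** T" b j] by (auto simp: matrix_vector_mul_assoc)
  qed
  have unscale: "x \<in> V" if "c *\<^sub>R x \<in> V" "subspace V" "c \<noteq> 0" for c :: real and x :: "real^'d" and V
    using subspace_scale[OF that(2,1), of "inverse c"] that(3) by simp
  have v_mem: "v j \<in> ?L j" if "1 \<le> j" "j \<le> k" "u j \<in> ?K j" "v (j - 1) \<in> ?L (j - 1)" for j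
  proof (rule unscale)
    have "v (j - 1) \<in> ?L j"
      using that(4) krylov_mono[of "j - 1" j] by auto
    then show "\<alpha> j *\<^sub>R v j \<in> ?L j"
      unfolding rec_v[OF that(1,2)]
      using T[OF that(3)] by (intro subspace_diff subspace_scale subspace_krylov)
  qed (use nz that subspace_krylov in auto)
  show ?thesis
    using \<open>1 \<le> j\<close> \<open>j \<le> k\<close>
  proof (induction j rule: nat_induct_at_least)
    case base
    have "\<beta> 1 *\<^sub>R u 1 \<in> ?K 1"
      using krylov_power_mem[of 0 1 "A ** T" b] start by simp
    then have "u 1 \<in> ?K 1"
      using unscale subspace_krylov nz base by blast
    \<comment> \<open>The Krylov space without generators is the zero space, which contains \<open>v 0\<close>.\<close>
    moreover have "v (1 - 1) \<in> ?L (1 - 1)"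
      using v0 subspace_0[OF subspace_krylov] by simp
    ultimately show ?case
      using v_mem base by blast
  next
    case (Suc j)
    then have IH: "u j \<in> ?K j" "v j \<in> ?L j"
      by simp_all
    have "u j \<in> ?K (Suc j)"
      using IH(1) krylov_mono[of j "Suc j"] by auto
    then have "\<beta> (Suc j) *\<^sub>R u (Suc j) \<in> ?K (Suc j)"
      using rec_u[of j] Suc A[OF IH(2)]
      by (simp add: subspace_diff subspace_scale subspace_krylov)
    then have "u (Suc j) \<in> ?K (Suc j)"
      using unscale subspace_krylov nz[of "Suc j"] Suc.prems by fastforce
    then show ?case
      using v_mem[of "Suc j"] IH(2) Suc.prems by simp
  qed
qed

theorem proposition1:
  fixes A :: "real^'n^'m" and b :: "real^'m"
    and M :: "real^'m^'m" and N :: "real^'n^'n"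
    and \<alpha> \<beta> :: "nat \<Rightarrow> real" and u :: "nat \<Rightarrow> real^'m" and v :: "nat \<Rightarrow> real^'n"
    and k :: nat
  assumes "sym_pos_def M" and "sym_pos_def N"
    and "1 \<le> k"
    and "gen_gkb A b M N k \<alpha> \<beta> u v"
    and "\<And>i. 1 \<le> i \<Longrightarrow> i \<le> k \<Longrightarrow> \<alpha> i \<noteq> 0 \<and> \<beta> i \<noteq> 0"
  shows "worthonormal (matrix_inv M) {1..k} u
    \<and> basis_of {1..k} u (krylov (A ** N ** transpose A ** matrix_inv M) b k)
    \<and> worthonormal (matrix_inv N) {1..k} v
    \<and> basis_of {1..k} v
        (krylov (N ** transpose A ** matrix_inv M ** A)
          ((N ** transpose A ** matrix_inv M) *v b) k)"
proof -
  define T where "T = N ** transpose A ** matrix_inv M"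
  have S: "wadjoint M N A = (*v) T"
    using wadjoint_eq assms(1,2) by (simp add: T_def)
  have invN: "matrix_inv N *v (N *v z) = z" for z
    by (simp add: matrix_vector_mul_assoc sym_pos_def_inv[OF assms(2)])
  have adj: "winner (matrix_inv M) (A *v x) y = winner (matrix_inv N) x (T *v y)" for x y
    unfolding T_def winner_def
    by (simp only: matrix_vector_mul_assoc[symmetric] invN)
      (metis dot_lmul_matrix inner_commute transpose_matrix_vector)
  have v0: "v 0 = 0" and start: "\<beta> 1 *\<^sub>R u 1 = b"
    and rec_v: "\<And>i. 1 \<le> i \<Longrightarrow> i \<le> k \<Longrightarrow> \<alpha> i *\<^sub>R v i = T *v u i - \<beta> i *\<^sub>R v (i - 1)"
    and rec_u: "\<And>i. 1 \<le> i \<Longrightarrow> i < k \<Longrightarrow> \<beta> (i + 1) *\<^sub>R u (i + 1) = A *v v i - \<alpha> i *\<^sub>R u i"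
    and unit_u: "\<And>i. 1 \<le> i \<Longrightarrow> i \<le> k \<Longrightarrow> winner (matrix_inv M) (u i) (u i) = 1"
    and unit_v: "\<And>i. 1 \<le> i \<Longrightarrow> i \<le> k \<Longrightarrow> winner (matrix_inv N) (v i) (v i) = 1"
    using assms(4) by (auto simp: gen_gkb_def S wnorm_def)
  have orth: "worthonormal (matrix_inv M) {1..k} u" "worthonormal (matrix_inv N) {1..k} v"
    using gkb_orthonormal[of "matrix_inv M" A "matrix_inv N" "(*v) T" v k \<alpha> u \<beta>,
        OF adj sym_pos_def_transpose_inv[OF assms(1)] sym_pos_def_transpose_inv[OF assms(2)]
          v0 rec_v rec_u unit_u unit_v assms(5)]
    by blast+
  have mem: "u j \<in> krylov (A ** T) b j \<and> v j \<in> krylov (T ** A) (T *v b) j"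
    if "1 \<le> j" "j \<le> k" for j
    using gkb_in_krylov[of v \<beta> u b k \<alpha> T A j, OF v0 start rec_v rec_u assms(5) that] .
  have AT: "A ** N ** transpose A ** matrix_inv M = A ** T"
    by (simp add: T_def matrix_mul_assoc)
  show ?thesis
    unfolding AT T_def[symmetric]
    using orth orthonormal_basis_of_krylov[OF orth(1)] orthonormal_basis_of_krylov[OF orth(2)] mem
    by blast
qed

end
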